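(* Over a prime field modulo $p$ and on a full-rank square $m\times m$ matrix with generic rank profile, with $m$ a power of two, the number of reductions modulo $p$ required by the elimination algorithms $\mathtt{PLUQ}$, $\mathtt{PLE}$ and $\mathtt{CUP}$ with full delayed reduction is $$R_{\mathtt{PLUQ}}(m,m)=2m^2+o(m^2),$$ $$R_{\mathtt{PLE}}(m,m)=R_{\mathtt{CUP}}(m,m)=\left(1+\tfrac14\log_2(m)\right)m^2+o(m^2).$$
   Context: Generic rank profile: all leading principal minors are nonzero (so no pivoting is needed). Full delayed reduction: elements of $\mathbb{Z}/p\mathbb{Z}$ are represented by integers, and reductions modulo $p$ are delayed across a single multiplication and any number of additions: an expression $\sum_i a_ib_i$ is reduced only once, at the end of the summation, whereas $a\cdot b\cdot c$ requires two reductions. Overflow is neglected. In this model the classical product of an $m\times k$ by a $k\times n$ matrix requires $R_{\mathrm{MM}}(m,k,n)=mn$ reductions, and solving a triangular system with an $m\times m$ triangular matrix and an $m\times n$ right-hand side requires $R_{\mathrm{UnitTRSM}}(m,n)=mn$ reductions if the triangular matrix has unit diagonal and $R_{\mathrm{TRSM}}(m,n)=2mn$ in general. $\mathtt{PLUQ}$: block recursive algorithm splitting rows and columns. On a full-rank $m\times m$ matrix $\begin{bmatrix}A_1&A_2\\ A_3&A_4\end{bmatrix}$ with generic rank profile and $\frac m2\times\frac m2$ blocks it consists of: a recursive call $A_1=L_1U_1$ ($L_1$ unit lower triangular, $U_1$ upper triangular); one triangular solving $D=L_1^{-1}A_2$ with a unit triangular matrix; one triangular solving $E=A_3U_1^{-1}$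 with a general triangular matrix; one multiplication with update $H=A_4-ED$; and a recursive call on $H$. On a $1\times1$ matrix it requires no reduction. $\mathtt{CUP}$ and $\mathtt{PLE}$: the row-oriented and column-oriented block recursive eliminations, splitting only one dimension (computing respectively $A=CUP$ with $C$ in column echelon form, and $A=PLE$ with $E$ in row echelon form), which have the same reduction count. On an $m\times n$ full-rank matrix with generic rank profile ($m\le n$, $m$ even), with the row splitting, the algorithm consists of: a recursive call on the $\frac m2\times n$ matrix of the top rows; one triangular solving with a general $\frac m2\times\frac m2$ triangular matrix and $\frac m2\times\frac m2$ right-hand side; one multiplication with update of dimensions $(\frac m2,\frac m2,n-\frac m2)$; and a recursive call on the resulting $\frac m2\times(n-\frac m2)$ matrix. On a $1\times n$ matrix it requires no reduction. *)

theory Defs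
  imports
    "Jordan_Normal_Form.Determinant"
    "HOL-Number_Theory.Modular_Inverse"
    "HOL-Library.Landau_Symbols"
begin

text \<open>
  Elements of the field of integers modulo a prime \<open>p\<close> are represented by integers, and every
  algorithm below returns, as its last component, the number of reductions modulo \<open>p\<close> it performs.
  The only operation that is charged is \<open>reduce\<close>. It is applied to an expression containing at
  most one level of products, after all the additions and subtractions: this is full delayed
  reduction. Integers are unbounded, so overflow does not arise. Inverses of diagonal elements
  are field operations and not reductions, and they are not charged.
\<close>

definition reduce :: "int \<Rightarrow> int \<Rightarrow> int \<times> nat" where
  "reduce p x = (x mod p, 1)"


subsection \<open>Matrices modulo \<open>p\<close>\<close>

definition reduced_mat :: "int \<Rightarrow> int mat \<Rightarrow> bool" where
  "reduced_mat p A \<longleftrightarrow> (\<forall>i<dim_row A. \<forall>j<dim_col A. A $$ (i,j) \<in> {0..<p})"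

text \<open>Full rank modulo \<open>p\<close>, for matrices with at most as many rows as columns:
  the rows are linearly independent modulo \<open>p\<close>.\<close>

definition full_rank_mod :: "int \<Rightarrow> int mat \<Rightarrow> bool" where
  "full_rank_mod p A \<longleftrightarrow>
     (\<forall>c :: nat \<Rightarrow> int.
        (\<forall>j<dim_col A. [(\<Sum>i<dim_row A. c i * A $$ (i,j)) = 0] (mod p)) \<longrightarrow>
        (\<forall>i<dim_row A. [c i = 0] (mod p)))"

definition generic_rank_profile_mod :: "int \<Rightarrow> int mat \<Rightarrow> bool" where
  "generic_rank_profile_mod p A \<longleftrightarrow>
     (\<forall>k\<in>{1..min (dim_row A) (dim_col A)}.
        \<not> [det (mat k k (\<lambda>(i,j). A $$ (i,j))) = 0] (mod p))"


subsection \<open>Matrix product with update\<close>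

definition mm_update :: "int \<Rightarrow> int mat \<Rightarrow> int mat \<Rightarrow> int mat \<Rightarrow> int mat \<times> nat" where
  "mm_update p A E D =
     (let entry = (\<lambda>i j. reduce p (A $$ (i,j) - row E i \<bullet> col D j))
      in (mat (dim_row A) (dim_col A) (\<lambda>(i,j). fst (entry i j)),
          \<Sum>i<dim_row A. \<Sum>j<dim_col A. snd (entry i j)))"


subsection \<open>Triangular solving by substitution\<close>

text \<open>The first \<open>i\<close> components of the solution \<open>x\<close> of \<open>L x = b\<close>, for \<open>L\<close> lower triangular.
  In the general case each component is an expression of the form \<open>(b - \<Sum> l \<cdot> x) \<cdot> d\<close>,
  which contains two levels of products and hence takes two reductions.\<close>

primrec unit_trsv :: "int \<Rightarrow> int mat \<Rightarrow> int vec \<Rightarrow> nat \<Rightarrow> int list \<times> nat" where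
  "unit_trsv p L b 0 = ([], 0)"
| "unit_trsv p L b (Suc i) =
     (let (xs, c) = unit_trsv p L b i;
          (x, d) = reduce p (b $ i - (\<Sum>k<i. L $$ (i,k) * xs ! k))
      in (xs @ [x], c + d))"

primrec trsv :: "int \<Rightarrow> int mat \<Rightarrow> int vec \<Rightarrow> nat \<Rightarrow> int list \<times> nat" where
  "trsv p L b 0 = ([], 0)"
| "trsv p L b (Suc i) =
     (let (xs, c) = trsv p L b i;
          (s, d) = reduce p (b $ i - (\<Sum>k<i. L $$ (i,k) * xs ! k));
          (x, e) = reduce p (s * modular_inverse p (L $$ (i,i)))
      in (xs @ [x], c + d + e))"

definition columnwise :: "(int vec \<Rightarrow> int list \<times> nat) \<Rightarrow> int mat \<Rightarrow> int mat \<times> nat" where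
  "columnwise solve B =
     (let sols = map (\<lambda>j. solve (col B j)) [0..<dim_col B]
      in (mat_of_cols (dim_row B) (map (\<lambda>s. vec_of_list (fst s)) sols), sum_list (map snd sols)))"

text \<open>\<open>L\<^sup>-\<^sup>1 B\<close> for \<open>L\<close> unit lower triangular, \<open>L\<^sup>-\<^sup>1 B\<close> for \<open>L\<close> lower triangular, and \<open>B U\<^sup>-\<^sup>1\<close> for \<open>U\<close>
  upper triangular; the last one solves the transposed system.\<close>

definition unit_trsm_lower_left :: "int \<Rightarrow> int mat \<Rightarrow> int mat \<Rightarrow> int mat \<times> nat" where
  "unit_trsm_lower_left p L B = columnwise (\<lambda>b. unit_trsv p L b (dim_row L)) B"

definition trsm_lower_left :: "int \<Rightarrow> int mat \<Rightarrow> int mat \<Rightarrow> int mat \<times> nat" where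
  "trsm_lower_left p L B = columnwise (\<lambda>b. trsv p L b (dim_row L)) B"

definition trsm_upper_right :: "int \<Rightarrow> int mat \<Rightarrow> int mat \<Rightarrow> int mat \<times> nat" where
  "trsm_upper_right p U B =
     (let (X, c) = trsm_lower_left p (transpose_mat U) (transpose_mat B)
      in (transpose_mat X, c))"


subsection \<open>Block recursive eliminations\<close>

text \<open>
  The eliminations are given on full-rank matrices with generic rank profile, where no pivoting
  takes place: the permutation factors are identities and are left out of the result.
  The result of \<open>pluq\<close> is \<open>(L, U, c)\<close> with \<open>L\<close> unit lower triangular and \<open>U\<close> upper triangular;
  the result of \<open>cup\<close> is \<open>(C, U, c)\<close> with \<open>C\<close> unit lower triangular, hence in column echelon form;
  the result of \<open>ple\<close> is \<open>(L, E, c)\<close> with \<open>E\<close> unit upper triangular, hence in row echelon form.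
\<close>

function pluq :: "int \<Rightarrow> int mat \<Rightarrow> int mat \<times> int mat \<times> nat" where
  "pluq p A =
     (if dim_row A \<le> 1 then (1\<^sub>m (dim_row A), A, 0)
      else
        let h = dim_row A div 2;
            (A1, A2, A3, A4) = split_block A h h;
            (L1, U1, c1) = pluq p A1;
            (D, cD) = unit_trsm_lower_left p L1 A2;
            (E, cE) = trsm_upper_right p U1 A3;
            (H, cH) = mm_update p A4 E D;
            (L2, U2, c2) = pluq p H
        in (four_block_mat L1 (0\<^sub>m (dim_row A1) (dim_col A4)) E L2,
            four_block_mat U1 D (0\<^sub>m (dim_row A4) (dim_col A1)) U2,
            c1 + cD + cE + cH + c2))"
  by pat_completeness auto
termination
  by (relation "measure (\<lambda>(p, A). dim_row A)")
     (auto simp: split_block_def mm_update_def Let_def)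

text \<open>Row splitting; the recursive call on the top rows yields \<open>C1\<close> and the block row \<open>[U1 V1]\<close>.\<close>

function cup :: "int \<Rightarrow> int mat \<Rightarrow> int mat \<times> int mat \<times> nat" where
  "cup p A =
     (if dim_row A \<le> 1 then (1\<^sub>m (dim_row A), A, 0)
      else
        let h = dim_row A div 2;
            top = mat h (dim_col A) (\<lambda>(i,j). A $$ (i,j));
            (A1, A2, A3, A4) = split_block A h h;
            (C1, UV, c1) = cup p top;
            (U1, V1, _, _) = split_block UV h h;
            (E, cE) = trsm_upper_right p U1 A3;
            (H, cH) = mm_update p A4 E V1;
            (C2, U2, c2) = cup p H
        in (four_block_mat C1 (0\<^sub>m h (dim_row A4)) E C2,
            four_block_mat U1 V1 (0\<^sub>m (dim_row A4) h) U2,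
            c1 + cE + cH + c2))"
  by pat_completeness auto
termination
  by (relation "measure (\<lambda>(p, A). dim_row A)")
     (auto simp: split_block_def mm_update_def Let_def)

text \<open>Column splitting; the recursive call on the left columns yields \<open>E1\<close> and the block column
  consisting of \<open>L1\<close> on top of \<open>M1\<close>.\<close>

function ple :: "int \<Rightarrow> int mat \<Rightarrow> int mat \<times> int mat \<times> nat" where
  "ple p A =
     (if dim_col A \<le> 1 then (A, 1\<^sub>m (dim_col A), 0)
      else
        let h = dim_col A div 2;
            left = mat (dim_row A) h (\<lambda>(i,j). A $$ (i,j));
            (A1, A2, A3, A4) = split_block A h h;
            (LM, E1, c1) = ple p left;
            (L1, _, M1, _) = split_block LM h h;
            (D, cD) = trsm_lower_left p L1 A2;
            (H, cH) = mm_update p A4 M1 D;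
            (L2, E2, c2) = ple p H
        in (four_block_mat L1 (0\<^sub>m h (dim_col A4)) M1 L2,
            four_block_mat E1 D (0\<^sub>m (dim_col A4) h) E2,
            c1 + cD + cH + c2))"
  by pat_completeness auto
termination
  by (relation "measure (\<lambda>(p, A). dim_col A)")
     (auto simp: split_block_def mm_update_def Let_def)

text \<open>The defining equations are not guarded by a constructor pattern and loop as rewrite rules.\<close>

declare pluq.simps [simp del] cup.simps [simp del] ple.simps [simp del]

definition pluq_reductions :: "int \<Rightarrow> int mat \<Rightarrow> nat" where
  "pluq_reductions p A = (case pluq p A of (L, U, c) \<Rightarrow> c)"

definition cup_reductions :: "int \<Rightarrow> int mat \<Rightarrow> nat" where
  "cup_reductions p A = (case cup p A of (C, U, c) \<Rightarrow> c)"

definition ple_reductions :: "int \<Rightarrow> int mat \<Rightarrow> nat" where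
  "ple_reductions p A = (case ple p A of (L, E, c) \<Rightarrow> c)"

end

theory Submission
  imports Defs "HOL-Real_Asymp.Real_Asymp"
begin

text \<open>
  No algorithm here branches on the entries of its input: there is no pivoting, and the recursion
  is controlled by the dimensions alone. Hence the number of reductions is a function of the
  dimensions, and it satisfies the recurrence read off from the algorithm. With \<open>h = 2\<^sup>k\<close> the recurrences are

    \<open>R(2h) = 2 R(h) + h\<^sup>2 + 2h\<^sup>2 + h\<^sup>2\<close> for PLUQ, and

    \<open>R(2h, n) = R(h, n) + 2h\<^sup>2 + h(n - h) + R(h, n - h)\<close> for CUP on \<open>2h \<times> n\<close> matrices with \<open>2h \<le> n\<close>.

  The column-oriented PLE leads to the second recurrence as well, with \<open>n\<close> the number of rows.
  The solution of the first one is \<open>R(m) = 2m\<^sup>2 - 2m\<close>. The second one preserves the class of functions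
  that are affine in \<open>n\<close>, and with \<open>m = 2\<^sup>k\<close> its solution is
  \<open>R(m, n) = (k/2) m n + (1 - k/4) m\<^sup>2 - m\<close>, so that \<open>R(m, m) = (1 + k/4) m\<^sup>2 - m\<close>. In both cases
  the error term is linear in \<open>m\<close>.

  The counts are obtained by induction on \<open>k\<close> in \<open>pluq_count\<close>, \<open>cup_count\<close> and \<open>ple_count\<close>;
  the induction also has to carry along the dimensions of the computed factors, because these are
  the operands of the triangular solvings and of the update.
\<close>


section \<open>Cost of the building blocks\<close>

lemma split_block_carrier:
  assumes "A \<in> carrier_mat (h + r) (g + s)"
  obtains A1 A2 A3 A4 where "split_block A h g = (A1, A2, A3, A4)"
    and "A1 \<in> carrier_mat h g" and "A2 \<in> carrier_mat h s"
    and "A3 \<in> carrier_mat r g" and "A4 \<in> carrier_mat r s"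
  using assms by (auto simp: split_block_def Let_def)

lemma mm_update_count:
  assumes "A \<in> carrier_mat m n"
  obtains H where "mm_update p A E D = (H, m * n)" and "H \<in> carrier_mat m n"
  using assms by (auto simp: mm_update_def Let_def reduce_def)

lemma snd_unit_trsv: "snd (unit_trsv p L b i) = i"
  by (induction i) (auto simp: reduce_def Let_def split: prod.splits)

lemma snd_trsv: "snd (trsv p L b i) = 2 * i"
  by (induction i) (auto simp: reduce_def Let_def split: prod.splits)

lemma columnwise_count:
  assumes "B \<in> carrier_mat m n" and "\<And>b. snd (solve b) = c"
  obtains X where "columnwise solve B = (X, n * c)" and "X \<in> carrier_mat m n"
  using assms
  by (intro that[of "fst (columnwise solve B)"])
    (auto simp: columnwise_def Let_def comp_def sum_list_triv)

lemma unit_trsm_lower_left_count: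
  assumes "L \<in> carrier_mat m m" and "B \<in> carrier_mat m n"
  obtains X where "unit_trsm_lower_left p L B = (X, m * n)" and "X \<in> carrier_mat m n"
  using columnwise_count[of B m n "\<lambda>b. unit_trsv p L b m" m] assms
  by (auto simp: unit_trsm_lower_left_def snd_unit_trsv mult.commute)

lemma trsm_lower_left_count:
  assumes "L \<in> carrier_mat m m" and "B \<in> carrier_mat m n"
  obtains X where "trsm_lower_left p L B = (X, 2 * m * n)" and "X \<in> carrier_mat m n"
  using columnwise_count[of B m n "\<lambda>b. trsv p L b m" "2 * m"] assms
  by (auto simp: trsm_lower_left_def snd_trsv ac_simps)

lemma trsm_upper_right_count:
  assumes "U \<in> carrier_mat n n" and "B \<in> carrier_mat m n"
  obtains X where "trsm_upper_right p U B = (X, 2 * m * n)" and "X \<in> carrier_mat m n"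
proof -
  obtain X where "trsm_lower_left p (transpose_mat U) (transpose_mat B) = (X, 2 * n * m)"
    and "X \<in> carrier_mat n m"
    using trsm_lower_left_count[of "transpose_mat U" n "transpose_mat B" m p] assms by auto
  then show ?thesis
    using that[of "transpose_mat X"] by (simp add: trsm_upper_right_def)
qed


section \<open>Recurrences for the eliminations\<close>

lemma pluq_count:
  assumes "A \<in> carrier_mat (2 ^ k) (2 ^ k)"
  shows "\<exists>L U. pluq p A = (L, U, 2 * 2 ^ k * (2 ^ k - 1)) \<and>
           L \<in> carrier_mat (2 ^ k) (2 ^ k) \<and> U \<in> carrier_mat (2 ^ k) (2 ^ k)"
  using assms
proof (induction k arbitrary: A)
  case 0
  then show ?case by (subst pluq.simps) auto
next
  case (Suc k)
  define h :: nat where "h = 2 ^ k"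
  have pos: "0 < h" by (simp add: h_def)
  have A: "A \<in> carrier_mat (2 * h) (2 * h)" using Suc.prems by (simp add: h_def)
  note IH = Suc.IH[folded h_def]
  obtain A1 A2 A3 A4 where split: "split_block A h h = (A1, A2, A3, A4)"
    and blocks: "A1 \<in> carrier_mat h h" "A2 \<in> carrier_mat h h"
      "A3 \<in> carrier_mat h h" "A4 \<in> carrier_mat h h"
    using split_block_carrier[OF A[unfolded mult_2]] .
  obtain L1 U1 where 1: "pluq p A1 = (L1, U1, 2 * h * (h - 1))"
    and LU1: "L1 \<in> carrier_mat h h" "U1 \<in> carrier_mat h h"
    using IH[OF blocks(1)] by auto
  obtain D where D: "unit_trsm_lower_left p L1 A2 = (D, h * h)" "D \<in> carrier_mat h h"
    using unit_trsm_lower_left_count[OF LU1(1) blocks(2)] .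
  obtain E where E: "trsm_upper_right p U1 A3 = (E, 2 * h * h)" "E \<in> carrier_mat h h"
    using trsm_upper_right_count[OF LU1(2) blocks(3)] .
  obtain H where H: "mm_update p A4 E D = (H, h * h)" "H \<in> carrier_mat h h"
    using mm_update_count[OF blocks(4)] .
  obtain L2 U2 where 2: "pluq p H = (L2, U2, 2 * h * (h - 1))"
    and LU2: "L2 \<in> carrier_mat h h" "U2 \<in> carrier_mat h h"
    using IH[OF H(2)] by auto
  have "2 * h * (h - 1) + h * h + 2 * h * h + h * h + 2 * h * (h - 1) = 2 * (2 * h) * (2 * h - 1)"
    using pos by (cases h) (auto simp: algebra_simps)
  then have "pluq p A =
      (four_block_mat L1 (0\<^sub>m h h) E L2, four_block_mat U1 D (0\<^sub>m h h) U2,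
       2 * (2 * h) * (2 * h - 1))"
    using pos A blocks by (subst pluq.simps) (simp add: split 1 D(1) E(1) H(1) 2)
  moreover have "four_block_mat L1 (0\<^sub>m h h) E L2 \<in> carrier_mat (2 * h) (2 * h)"
    and "four_block_mat U1 D (0\<^sub>m h h) U2 \<in> carrier_mat (2 * h) (2 * h)"
    using LU1 LU2 by (auto simp: mult_2)
  ultimately show ?case by (simp add: h_def)
qed

text \<open>The common count of CUP on \<open>2\<^sup>k \<times> n\<close> matrices and of PLE on \<open>n \<times> 2\<^sup>k\<close> matrices.\<close>

primrec one_sided_count :: "nat \<Rightarrow> nat \<Rightarrow> nat" where
  "one_sided_count 0 n = 0"
| "one_sided_count (Suc k) n =
     one_sided_count k n + 2 * 2 ^ k * 2 ^ k + 2 ^ k * (n - 2 ^ k) + one_sided_count k (n - 2 ^ k)"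

text \<open>The right-hand side is affine in \<open>n\<close>, and the shift from \<open>n\<close> to \<open>n - 2\<^sup>k\<close> in the second recursive
  call only contributes to its constant term.\<close>

lemma one_sided_count_closed_form:
  assumes "2 ^ k \<le> n"
  shows "real (one_sided_count k n) =
    real k / 2 * 2 ^ k * real n + (1 - real k / 4) * (2 ^ k)\<^sup>2 - 2 ^ k"
  using assms
proof (induction k arbitrary: n)
  case (Suc k)
  then have le: "2 ^ k \<le> n" "2 ^ k \<le> n - 2 ^ k" by auto
  show ?case
    using Suc.IH[OF le(1)] Suc.IH[OF le(2)] le(1)
    by (simp add: of_nat_diff field_simps power2_eq_square)
qed simp

lemma cup_count:
  assumes "A \<in> carrier_mat (2 ^ k) n" and "2 ^ k \<le> n"
  shows "\<exists>C U. cup p A = (C, U, one_sided_count k n) \<and>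
           C \<in> carrier_mat (2 ^ k) (2 ^ k) \<and> U \<in> carrier_mat (2 ^ k) n"
  using assms
proof (induction k arbitrary: A n)
  case 0
  then show ?case by (subst cup.simps) auto
next
  case (Suc k)
  define h :: nat where "h = 2 ^ k"
  have pos: "0 < h" by (simp add: h_def)
  have A: "A \<in> carrier_mat (2 * h) n" and n: "h \<le> n" "h \<le> n - h"
    using Suc.prems by (auto simp: h_def)
  note IH = Suc.IH[folded h_def]
  have "A \<in> carrier_mat (h + h) (h + (n - h))" using A n(1) by (simp add: mult_2)
  then obtain A1 A2 A3 A4 where split: "split_block A h h = (A1, A2, A3, A4)"
    and blocks: "A1 \<in> carrier_mat h h" "A2 \<in> carrier_mat h (n - h)"
      "A3 \<in> carrier_mat h h" "A4 \<in> carrier_mat h (n - h)"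
    by (rule split_block_carrier)
  define upper where "upper = mat h n (($$) A)"
  have upper: "upper \<in> carrier_mat h n" by (simp add: upper_def)
  obtain C1 UV where 1: "cup p upper = (C1, UV, one_sided_count k n)"
    and C1: "C1 \<in> carrier_mat h h" and UV: "UV \<in> carrier_mat h n"
    using IH[OF upper n(1)] by auto
  have "UV \<in> carrier_mat (h + 0) (h + (n - h))" using UV n(1) by simp
  then obtain U1 V1 X Y where splitUV: "split_block UV h h = (U1, V1, X, Y)"
    and U1: "U1 \<in> carrier_mat h h"
    by (rule split_block_carrier)
  obtain E where E: "trsm_upper_right p U1 A3 = (E, 2 * h * h)" "E \<in> carrier_mat h h"
    using trsm_upper_right_count[OF U1 blocks(3)] .
  obtain H where H: "mm_update p A4 E V1 = (H, h * (n - h))" "H \<in> carrier_mat h (n - h)"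
    using mm_update_count[OF blocks(4)] .
  obtain C2 U2 where 2: "cup p H = (C2, U2, one_sided_count k (n - h))"
    and C2: "C2 \<in> carrier_mat h h" and U2: "U2 \<in> carrier_mat h (n - h)"
    using IH[OF H(2) n(2)] by auto
  have "cup p A =
      (four_block_mat C1 (0\<^sub>m h h) E C2, four_block_mat U1 V1 (0\<^sub>m h h) U2,
       one_sided_count (Suc k) n)"
    using pos A blocks
    by (subst cup.simps) (simp add: split upper_def[symmetric] 1 splitUV E(1) H(1) 2 h_def[symmetric])
  moreover have "four_block_mat C1 (0\<^sub>m h h) E C2 \<in> carrier_mat (2 * h) (2 * h)"
    using C1 C2 by (auto simp: mult_2)
  moreover have "four_block_mat U1 V1 (0\<^sub>m h h) U2 \<in> carrier_mat (2 * h) n"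
    using four_block_carrier_mat[OF U1 U2] n(1) by (simp add: mult_2)
  ultimately show ?case by (simp add: h_def)
qed

lemma ple_count:
  assumes "A \<in> carrier_mat n (2 ^ k)" and "2 ^ k \<le> n"
  shows "\<exists>L E. ple p A = (L, E, one_sided_count k n) \<and>
           L \<in> carrier_mat n (2 ^ k) \<and> E \<in> carrier_mat (2 ^ k) (2 ^ k)"
  using assms
proof (induction k arbitrary: A n)
  case 0
  then show ?case by (subst ple.simps) auto
next
  case (Suc k)
  define h :: nat where "h = 2 ^ k"
  have pos: "0 < h" by (simp add: h_def)
  have A: "A \<in> carrier_mat n (2 * h)" and n: "h \<le> n" "h \<le> n - h"
    using Suc.prems by (auto simp: h_def)
  note IH = Suc.IH[folded h_def]
  have "A \<in> carrier_mat (h + (n - h)) (h + h)" using A n(1) by (simp add: mult_2)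
  then obtain A1 A2 A3 A4 where split: "split_block A h h = (A1, A2, A3, A4)"
    and blocks: "A1 \<in> carrier_mat h h" "A2 \<in> carrier_mat h h"
      "A3 \<in> carrier_mat (n - h) h" "A4 \<in> carrier_mat (n - h) h"
    by (rule split_block_carrier)
  define left where "left = mat n h (($$) A)"
  have left: "left \<in> carrier_mat n h" by (simp add: left_def)
  obtain LM E1 where 1: "ple p left = (LM, E1, one_sided_count k n)"
    and LM: "LM \<in> carrier_mat n h" and E1: "E1 \<in> carrier_mat h h"
    using IH[OF left n(1)] by auto
  have "LM \<in> carrier_mat (h + (n - h)) (h + 0)" using LM n(1) by simp
  then obtain L1 X M1 Y where splitLM: "split_block LM h h = (L1, X, M1, Y)"
    and L1: "L1 \<in> carrier_mat h h"
    by (rule split_block_carrier)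
  obtain D where D: "trsm_lower_left p L1 A2 = (D, 2 * h * h)" "D \<in> carrier_mat h h"
    using trsm_lower_left_count[OF L1 blocks(2)] .
  obtain H where H: "mm_update p A4 M1 D = (H, (n - h) * h)" "H \<in> carrier_mat (n - h) h"
    using mm_update_count[OF blocks(4)] .
  obtain L2 E2 where 2: "ple p H = (L2, E2, one_sided_count k (n - h))"
    and L2: "L2 \<in> carrier_mat (n - h) h" and E2: "E2 \<in> carrier_mat h h"
    using IH[OF H(2) n(2)] by auto
  have "ple p A =
      (four_block_mat L1 (0\<^sub>m h h) M1 L2, four_block_mat E1 D (0\<^sub>m h h) E2,
       one_sided_count (Suc k) n)"
    using pos A blocks
    by (subst ple.simps)
      (simp add: split left_def[symmetric] 1 splitLM D(1) H(1) 2 h_def[symmetric] mult.commute)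
  moreover have "four_block_mat L1 (0\<^sub>m h h) M1 L2 \<in> carrier_mat n (2 * h)"
    using four_block_carrier_mat[OF L1 L2] n(1) by (simp add: mult_2)
  moreover have "four_block_mat E1 D (0\<^sub>m h h) E2 \<in> carrier_mat (2 * h) (2 * h)"
    using E1 E2 by (auto simp: mult_2)
  ultimately show ?case by (simp add: h_def)
qed


section \<open>Asymptotics\<close>

lemma pow2_smallo_square: "(\<lambda>k. c * 2 ^ k) \<in> o(\<lambda>k. real (2 ^ k) ^ 2)"
proof -
  have "(\<lambda>k. 2 ^ k) \<in> o(\<lambda>k::nat. (2 ^ k)\<^sup>2 :: real)" by real_asymp
  then have "(\<lambda>k. c * 2 ^ k) \<in> o(\<lambda>k::nat. (2 ^ k)\<^sup>2 :: real)"
    by (cases "c = 0") simp_all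
  then show ?thesis by (simp only: of_nat_power of_nat_numeral)
qed

theorem theorem4:
  shows "\<exists>R_PLUQ R_PLE R_CUP :: nat \<Rightarrow> nat.
    (\<forall>(p :: int) (k :: nat) (m :: nat) (A :: int mat).
        prime p \<longrightarrow> m = 2 ^ k \<longrightarrow> A \<in> carrier_mat m m \<longrightarrow> reduced_mat p A \<longrightarrow>
        full_rank_mod p A \<longrightarrow> generic_rank_profile_mod p A \<longrightarrow>
          pluq_reductions p A = R_PLUQ m \<and>
          ple_reductions p A = R_PLE m \<and>
          cup_reductions p A = R_CUP m) \<and>
    (\<lambda>k. real (R_PLUQ (2 ^ k)) - 2 * real (2 ^ k) ^ 2)
       \<in> o(\<lambda>k. real (2 ^ k) ^ 2) \<and>
    (\<forall>k. R_PLE (2 ^ k) = R_CUP (2 ^ k)) \<and>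
    (\<lambda>k. real (R_PLE (2 ^ k)) - (1 + 1 / 4 * log 2 (real (2 ^ k))) * real (2 ^ k) ^ 2)
       \<in> o(\<lambda>k. real (2 ^ k) ^ 2)"
proof -
  define R where "R = (\<lambda>m::nat. 2 * m * (m - 1))"
  \<comment> \<open>The recursion depth is recovered from the dimension, which is a power of two.\<close>
  define S where "S = (\<lambda>m. one_sided_count (nat \<lfloor>log 2 (real m)\<rfloor>) m)"
  have log: "log 2 (2 ^ k) = real k" for k
    by (simp add: log_nat_power)
  have S: "S (2 ^ k) = one_sided_count k (2 ^ k)" for k
    by (simp add: S_def log)
  have counts: "pluq_reductions p A = R (2 ^ k) \<and> ple_reductions p A = S (2 ^ k) \<and>
      cup_reductions p A = S (2 ^ k)" if "A \<in> carrier_mat (2 ^ k) (2 ^ k)" for p k A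
    using pluq_count[OF that, of p] ple_count[OF that, of p] cup_count[OF that, of p]
    by (auto simp: pluq_reductions_def ple_reductions_def cup_reductions_def R_def S)
  have R_error: "real (R (2 ^ k)) - 2 * real (2 ^ k) ^ 2 = - 2 * 2 ^ k" for k
  proof -
    have "real (R (2 ^ k)) = 2 * 2 ^ k * (2 ^ k - 1)"
      by (simp add: R_def of_nat_diff)
    also have "\<dots> = 2 * (2 ^ k)\<^sup>2 - 2 * 2 ^ k"
      by (simp only: power2_eq_square right_diff_distrib mult_1_right mult.assoc)
    finally show ?thesis by simp
  qed
  have S_error: "real (S (2 ^ k)) - (1 + 1 / 4 * log 2 (real (2 ^ k))) * real (2 ^ k) ^ 2 =
      - 1 * 2 ^ k" for k
  proof -
    have "real k / 2 * x * x + (1 - real k / 4) * x\<^sup>2 - x - (1 + 1 / 4 * real k) * x\<^sup>2 = - 1 * x"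
      for x :: real
      by (simp add: field_simps power2_eq_square)
    from this[of "2 ^ k"] show ?thesis
      using one_sided_count_closed_form[of k "2 ^ k"] by (simp add: S log)
  qed
  have "(\<lambda>k. real (R (2 ^ k)) - 2 * real (2 ^ k) ^ 2) \<in> o(\<lambda>k. real (2 ^ k) ^ 2)"
    unfolding R_error by (rule pow2_smallo_square)
  moreover have "(\<lambda>k. real (S (2 ^ k)) - (1 + 1 / 4 * log 2 (real (2 ^ k))) * real (2 ^ k) ^ 2)
      \<in> o(\<lambda>k. real (2 ^ k) ^ 2)"
    unfolding S_error by (rule pow2_smallo_square)
  ultimately show ?thesis
    using counts by (intro exI[of _ R] exI[of _ S] conjI allI impI) simp_all
qed

end
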